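(* Let $R$ be a finite Boolean ring with $|R|=2^n$, where $n\ge 1$. Then, for every integer $k\ge 2$, $$\zeta_k(R)=\left(1-\frac{1}{2^k}\right)^n.$$
   Context: For a finite commutative ring $R$, let $\mathcal I(R)$ denote the set of all ideals of $R$. For an integer $k\ge 2$, the ideal zero-product probability is $$\zeta_k(R)=\frac{|\{(I_1,\ldots,I_k)\in\mathcal I(R)^k : I_1I_2\cdots I_k=(0)\}|}{|\mathcal I(R)|^k},$$ where $I_1\cdots I_k$ is the usual product of ideals. A Boolean ring is a ring in which $x^2=x$ for every element $x$. *)

theory Defs
  imports Complex_Main "HOL-Algebra.Ideal_Product" "HOL-Library.FuncSet"
begin

locale boolean_ring = ring +
  assumes idem: "x \<in> carrier R \<Longrightarrow> x \<otimes> x = x"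

lemma (in boolean_ring) add_self:
  assumes x: "x \<in> carrier R"
  shows "x \<oplus> x = \<zero>"
proof -
  have "(x \<oplus> x) \<oplus> (x \<oplus> x) = (x \<otimes> x \<oplus> x \<otimes> x) \<oplus> (x \<otimes> x \<oplus> x \<otimes> x)"
    using x idem by simp
  also have "\<dots> = (x \<oplus> x) \<otimes> (x \<oplus> x)"
    using x by (simp only: l_distr r_distr a_closed m_closed)
  also have "\<dots> = x \<oplus> x"
    using x by (simp add: idem)
  finally show ?thesis
    using x add.l_cancel_one[of "x \<oplus> x" "x \<oplus> x"] by simp
qed

sublocale boolean_ring \<subseteq> cring
proof (unfold_locales)
  fix x y assume x: "x \<in> carrier R" and y: "y \<in> carrier R"
  have xy: "x \<otimes> y \<in> carrier R" "y \<otimes> x \<in> carrier R" using x y by auto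
  have "(x \<oplus> y) \<oplus> (x \<otimes> y \<oplus> y \<otimes> x) = (x \<otimes> x \<oplus> y \<otimes> x) \<oplus> (x \<otimes> y \<oplus> y \<otimes> y)"
    using x y xy idem by (simp add: a_ac)
  also have "\<dots> = (x \<oplus> y) \<otimes> (x \<oplus> y)"
    using x y by (simp only: l_distr r_distr a_closed m_closed)
  also have "\<dots> = x \<oplus> y"
    using x y by (simp add: idem)
  finally have "x \<otimes> y \<oplus> y \<otimes> x = \<zero>"
    using x y xy add.r_cancel_one[of "x \<oplus> y" "x \<otimes> y \<oplus> y \<otimes> x"] by simp
  with add_self[OF xy(2)] xy show "x \<otimes> y = y \<otimes> x"
    using add.right_cancel[of "y \<otimes> x" "x \<otimes> y" "y \<otimes> x"] by simp
qed

text \<open>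
  A \<open>k\<close>-tuple of ideals is an extensional function on \<open>{1..k}\<close>, and the product
  \<open>I\<^sub>1 \<cdots> I\<^sub>k\<close> is taken in the commutative monoid \<open>ideals_set R\<close> of ideals of \<open>R\<close>
  under ideal multiplication. The definition is meaningful for finite commutative \<open>R\<close>.
\<close>

definition zeta :: "nat \<Rightarrow> ('a, 'b) ring_scheme \<Rightarrow> real" where
  "zeta k R =
     real (card {I \<in> {1..k} \<rightarrow>\<^sub>E {J. ideal J R}.
                   (\<Otimes>\<^bsub>ideals_set R\<^esub> i \<in> {1..k}. I i) = {\<zero>\<^bsub>R\<^esub>}})
     / real (card {J. ideal J R}) ^ k"

end

(*
  In a Boolean ring the product of two ideals is their intersection, because x = x x. If the ring is
  finite, an element is determined by the set of atoms (minimal nonzero elements) that it dominates,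
  every set of atoms occurs, and an ideal is determined by the atoms it contains. So card R = 2 ^ n
  forces n atoms, and the tuples of ideals with zero product correspond to the k-tuples of subsets of
  an n-set with empty intersection. Such a tuple assigns to each of the n atoms a proper subset of
  the k positions, which gives (2 ^ k - 1) ^ n tuples.
*)
theory Submission
  imports Defs
begin

section \<open>Tuples of subsets with empty intersection\<close>

lemma card_tuples_empty_Inter:
  assumes "finite A" "finite K" "K \<noteq> {}"
  shows "card {F \<in> K \<rightarrow>\<^sub>E Pow A. (\<Inter>i\<in>K. F i) = {}} = (2 ^ card K - 1) ^ card A"
proof -
  \<comment> \<open>Transpose the incidence relation: each \<open>a\<close> goes to the set of
    positions whose member contains it. The intersection is empty exactly when no \<open>a\<close>
    gets the full set \<open>K\<close>, so only that value is excluded.\<close>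
  have "bij_betw (\<lambda>F. \<lambda>a\<in>A. {i\<in>K. a \<in> F i})
     {F \<in> K \<rightarrow>\<^sub>E Pow A. (\<Inter>i\<in>K. F i) = {}} (A \<rightarrow>\<^sub>E Pow K - {K})"
  proof (rule bij_betw_byWitness[where f' = "\<lambda>g. \<lambda>i\<in>K. {a\<in>A. i \<in> g a}"])
    show "\<forall>F\<in>{F \<in> K \<rightarrow>\<^sub>E Pow A. (\<Inter>i\<in>K. F i) = {}}.
        (\<lambda>i\<in>K. {a\<in>A. i \<in> (\<lambda>a\<in>A. {i\<in>K. a \<in> F i}) a}) = F"
      by (auto simp: PiE_iff extensional_def restrict_def fun_eq_iff)
    show "\<forall>g\<in>A \<rightarrow>\<^sub>E Pow K - {K}. (\<lambda>a\<in>A. {i\<in>K. a \<in> (\<lambda>i\<in>K. {a\<in>A. i \<in> g a}) i}) = g"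
      by (auto simp: PiE_iff extensional_def restrict_def fun_eq_iff)
    show "(\<lambda>F. \<lambda>a\<in>A. {i\<in>K. a \<in> F i}) ` {F \<in> K \<rightarrow>\<^sub>E Pow A. (\<Inter>i\<in>K. F i) = {}}
        \<subseteq> A \<rightarrow>\<^sub>E Pow K - {K}"
    proof (rule image_subsetI)
      fix F assume "F \<in> {F \<in> K \<rightarrow>\<^sub>E Pow A. (\<Inter>i\<in>K. F i) = {}}"
      then have "{i\<in>K. a \<in> F i} \<noteq> K" for a by blast
      then show "(\<lambda>a\<in>A. {i\<in>K. a \<in> F i}) \<in> A \<rightarrow>\<^sub>E Pow K - {K}" by auto
    qed
    show "(\<lambda>g. \<lambda>i\<in>K. {a\<in>A. i \<in> g a}) ` (A \<rightarrow>\<^sub>E Pow K - {K})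
        \<subseteq> {F \<in> K \<rightarrow>\<^sub>E Pow A. (\<Inter>i\<in>K. F i) = {}}"
      \<comment> \<open>A position in \<open>K\<close> forces points of the intersection into
        \<open>A\<close>; over an empty \<open>K\<close> the intersection would be the whole
        type.\<close>
      using \<open>K \<noteq> {}\<close> by (auto simp: PiE_iff) blast
  qed
  then have "card {F \<in> K \<rightarrow>\<^sub>E Pow A. (\<Inter>i\<in>K. F i) = {}} = card (A \<rightarrow>\<^sub>E Pow K - {K})"
    by (rule bij_betw_same_card)
  also have "\<dots> = (2 ^ card K - 1) ^ card A"
    using assms by (simp add: card_PiE card_Pow)
  finally show ?thesis .
qed

lemma bij_betw_PiE_comp:
  assumes "bij_betw f A B"
  shows "bij_betw (\<lambda>x. \<lambda>i\<in>K. f (x i)) (K \<rightarrow>\<^sub>E A) (K \<rightarrow>\<^sub>E B)"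
proof (rule bij_betw_byWitness[where f' = "\<lambda>y. \<lambda>i\<in>K. the_inv_into A f (y i)"])
  have g: "bij_betw (the_inv_into A f) B A"
    using assms by (rule bij_betw_the_inv_into)
  show "\<forall>x\<in>K \<rightarrow>\<^sub>E A. (\<lambda>i\<in>K. the_inv_into A f ((\<lambda>i\<in>K. f (x i)) i)) = x"
    using the_inv_into_f_f[OF bij_betw_imp_inj_on[OF assms]]
    by (auto simp: fun_eq_iff PiE_iff extensional_def)
  show "\<forall>y\<in>K \<rightarrow>\<^sub>E B. (\<lambda>i\<in>K. f ((\<lambda>i\<in>K. the_inv_into A f (y i)) i)) = y"
    using f_the_inv_into_f_bij_betw[OF assms]
    by (auto simp: fun_eq_iff PiE_iff extensional_def)
  show "(\<lambda>x. \<lambda>i\<in>K. f (x i)) ` (K \<rightarrow>\<^sub>E A) \<subseteq> K \<rightarrow>\<^sub>E B"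
    using bij_betwE[OF assms] by auto
  show "(\<lambda>y. \<lambda>i\<in>K. the_inv_into A f (y i)) ` (K \<rightarrow>\<^sub>E B) \<subseteq> K \<rightarrow>\<^sub>E A"
    using bij_betwE[OF g] by auto
qed

section \<open>Products of ideals as intersections\<close>

lemma ideal_Int:
  assumes "ideal I R" "ideal J R"
  shows "ideal (I \<inter> J) R"
  using assms by (rule ring.i_intersect[OF ideal.axioms(2)[OF assms(1)]])

context boolean_ring
begin

lemma ideal_prod_eq_Int:
  assumes "ideal I R" "ideal J R"
  shows "I \<cdot> J = I \<inter> J"
proof
  show "I \<inter> J \<subseteq> I \<cdot> J"
  proof
    fix x assume x: "x \<in> I \<inter> J"
    then have "x \<otimes> x \<in> I \<cdot> J" by (auto intro: ideal_prod.prod)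
    then show "x \<in> I \<cdot> J" using x assms by (auto simp: idem ideal.Icarr)
  qed
qed (rule ideal_prod_inter[OF assms])

text \<open>The induction starts at a singleton because the empty product is
  \<open>carrier R\<close>, while the empty intersection is the whole type. The second conjunct lets
  \<open>ideal_prod_eq_Int\<close> apply in the induction step.\<close>

lemma finprod_ideals_set_eq_Inter:
  assumes "finite K" "K \<noteq> {}" "\<And>i. i \<in> K \<Longrightarrow> ideal (I i) R"
  shows "(\<Otimes>\<^bsub>ideals_set R\<^esub> i \<in> K. I i) = (\<Inter>i\<in>K. I i) \<and> ideal (\<Inter>i\<in>K. I i) R"
  using assms
proof (induction K rule: finite_ne_induct)
  case (singleton x)
  interpret S: comm_monoid "ideals_set R" by (rule ideals_set_is_comm_monoid)
  have "I x \<in> carrier (ideals_set R)"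
    using singleton by (simp add: ideals_set_def)
  then show ?case using singleton by simp
next
  case (insert x F)
  interpret S: comm_monoid "ideals_set R" by (rule ideals_set_is_comm_monoid)
  have "I \<in> F \<rightarrow> carrier (ideals_set R)" "I x \<in> carrier (ideals_set R)"
    using insert by (auto simp: ideals_set_def)
  with insert.hyps have "(\<Otimes>\<^bsub>ideals_set R\<^esub> i \<in> insert x F. I i)
      = I x \<cdot> (\<Otimes>\<^bsub>ideals_set R\<^esub> i \<in> F. I i)"
    by (subst S.finprod_insert) (simp_all add: ideals_set_def)
  with insert.prems insert.IH show ?case
    by (simp add: ideal_prod_eq_Int ideal_Int)
qed

section \<open>Atoms and the elements above them\<close>

definition atoms :: "'a set" where
  "atoms = {a \<in> carrier R. a \<noteq> \<zero> \<and> (\<forall>x\<in>carrier R. a \<otimes> x = \<zero> \<or> a \<otimes> x = a)}"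

text \<open>The relation \<open>a \<otimes> x = a\<close> is the order of the Boolean algebra; the
  elements below \<open>a\<close> are exactly its multiples.\<close>

definition atoms_below :: "'a \<Rightarrow> 'a set" where
  "atoms_below x = {a \<in> atoms. a \<otimes> x = a}"

lemma atoms_carrier: "a \<in> atoms \<Longrightarrow> a \<in> carrier R"
  and atoms_nonzero: "a \<in> atoms \<Longrightarrow> a \<noteq> \<zero>"
  and atoms_mult: "a \<in> atoms \<Longrightarrow> x \<in> carrier R \<Longrightarrow> a \<otimes> x \<noteq> a \<Longrightarrow> a \<otimes> x = \<zero>"
  by (auto simp: atoms_def)

lemma atoms_below_zero: "atoms_below \<zero> = {}"
  using atoms_carrier atoms_nonzero by (force simp: atoms_below_def)

text \<open>The product is a multiple of both atoms; if nonzero, it would equal each of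
  them.\<close>

lemma atoms_orthogonal:
  assumes "a \<in> atoms" "b \<in> atoms" "a \<noteq> b"
  shows "a \<otimes> b = \<zero>"
  using assms atoms_mult[of a b] atoms_mult[of b a] m_comm[of a b] atoms_carrier by metis

lemma atoms_below_atom: "a \<in> atoms \<Longrightarrow> atoms_below a = {a}"
  using atoms_orthogonal[of _ a] atoms_nonzero atoms_carrier
  by (force simp: atoms_below_def idem)

text \<open>An atom \<open>a\<close> multiplies every element to \<open>\<zero>\<close> or
  \<open>a\<close>. Since \<open>a \<oplus> a = \<zero>\<close>, addition turns into symmetric
  difference.\<close>

lemma atoms_below_add:
  assumes "x \<in> carrier R" "y \<in> carrier R"
  shows "atoms_below (x \<oplus> y) = (atoms_below x - atoms_below y) \<union> (atoms_below y - atoms_below x)"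
proof -
  have "a \<otimes> (x \<oplus> y) = a \<longleftrightarrow> (a \<otimes> x = a) \<noteq> (a \<otimes> y = a)" if a: "a \<in> atoms" for a
  proof -
    have "a \<otimes> (x \<oplus> y) = a \<otimes> x \<oplus> a \<otimes> y"
      using assms a atoms_carrier by (simp add: r_distr)
    then show ?thesis
      using atoms_mult[OF a assms(1)] atoms_mult[OF a assms(2)] atoms_nonzero[OF a]
        atoms_carrier[OF a] add_self[of a]
      by (cases "a \<otimes> x = a"; cases "a \<otimes> y = a"; simp)
  qed
  then show ?thesis by (auto simp: atoms_below_def)
qed

lemma atoms_below_mult:
  assumes "x \<in> carrier R" "y \<in> carrier R"
  shows "atoms_below (x \<otimes> y) \<subseteq> atoms_below y"
proof
  fix a assume a: "a \<in> atoms_below (x \<otimes> y)"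
  then have ac: "a \<in> carrier R" and e: "a \<otimes> (x \<otimes> y) = a"
    by (auto simp: atoms_below_def dest: atoms_carrier)
  have "a \<otimes> y = a \<otimes> (x \<otimes> y) \<otimes> y" using e by simp
  also have "\<dots> = a \<otimes> (x \<otimes> (y \<otimes> y))" using ac assms by (simp add: m_assoc)
  finally show "a \<in> atoms_below y" using a e assms by (simp add: atoms_below_def idem)
qed

text \<open>Descent: a nonzero element that is not an atom has a nonzero multiple strictly below it.
  The measure counts the elements below \<open>x\<close>.\<close>

lemma atoms_below_nonempty:
  assumes "finite (carrier R)" "x \<in> carrier R" "x \<noteq> \<zero>"
  shows "atoms_below x \<noteq> {}"
  using assms(2,3)
proof (induction "card {v \<in> carrier R. v \<otimes> x = v}" arbitrary: x rule: less_induct)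
  case (less x)
  show ?case
  proof (cases "x \<in> atoms")
    case True
    then show ?thesis using atoms_below_atom by simp
  next
    case False
    then obtain w where w: "w \<in> carrier R" "x \<otimes> w \<noteq> \<zero>" "x \<otimes> w \<noteq> x"
      using less.prems by (auto simp: atoms_def)
    let ?y = "w \<otimes> x"
    have y: "?y \<in> carrier R" "?y \<noteq> \<zero>" "x \<otimes> ?y \<noteq> x" "?y \<otimes> x = ?y"
      using w less.prems m_comm[of w x] idem m_assoc[of x x w] m_assoc[of w x x] by auto
    have "v \<otimes> x = v" if "v \<in> carrier R" "v \<otimes> ?y = v" for v
      using that y w less.prems m_assoc[of v ?y x] by metis
    \<comment> \<open>The inclusion is strict because \<open>x\<close> lies below itself but not
      below \<open>?y\<close>.\<close>
    then have "{v \<in> carrier R. v \<otimes> ?y = v} \<subset> {v \<in> carrier R. v \<otimes> x = v}"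
      using y less.prems idem by blast
    then have "atoms_below ?y \<noteq> {}"
      using less.hyps[OF psubset_card_mono y(1,2)] assms(1) by simp
    then show ?thesis using atoms_below_mult[of w x] w less.prems by blast
  qed
qed

text \<open>If \<open>x\<close> and \<open>y\<close> dominate the same atoms, then
  \<open>x \<oplus> y\<close> dominates none and is zero; in characteristic two this gives
  \<open>x = y\<close>.\<close>

lemma inj_on_atoms_below:
  assumes "finite (carrier R)"
  shows "inj_on atoms_below (carrier R)"
proof (rule inj_onI)
  fix x y assume xy: "x \<in> carrier R" "y \<in> carrier R" "atoms_below x = atoms_below y"
  then have "atoms_below (x \<oplus> y) = {}" by (simp add: atoms_below_add)
  then have "x \<oplus> y = \<zero>" using atoms_below_nonempty[OF assms] xy by blast
  then show "x = y" using xy add_self[of y] add.right_cancel by metis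
qed

text \<open>The witness is the sum of the atoms in \<open>S\<close>. Keeping it inside
  \<open>J\<close> serves both the whole ring and the membership test for ideals.\<close>

lemma ex_atoms_below_eq:
  assumes "ideal J R" "finite S" "S \<subseteq> J \<inter> atoms"
  shows "\<exists>x\<in>J. atoms_below x = S"
  using assms(2,3)
proof (induction S rule: finite_induct)
  case empty
  have "\<zero> \<in> J" using assms(1) by (simp add: additive_subgroup.zero_closed ideal.axioms(1))
  then show ?case using atoms_below_zero by blast
next
  case (insert a S)
  then obtain x where x: "x \<in> J" "atoms_below x = S" by auto
  have a: "a \<in> J" "a \<in> atoms" using insert.prems by auto
  have "atoms_below (x \<oplus> a) = insert a S"
    using atoms_below_add[of x a] x a atoms_below_atom[OF a(2)] insert.hyps assms(1)
    by (auto simp: ideal.Icarr)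
  moreover have "x \<oplus> a \<in> J"
    using x a assms(1) by (simp add: additive_subgroup.a_closed ideal.axioms(1))
  ultimately show ?case by blast
qed

section \<open>Elements and ideals as sets of atoms\<close>

lemma finite_atoms: "finite (carrier R) \<Longrightarrow> finite atoms"
  by (rule finite_subset[of _ "carrier R"]) (auto simp: atoms_def)

lemma bij_betw_atoms_below:
  assumes "finite (carrier R)"
  shows "bij_betw atoms_below (carrier R) (Pow atoms)"
proof -
  have "\<exists>x\<in>carrier R. atoms_below x = S" if "S \<subseteq> atoms" for S
    using ex_atoms_below_eq[OF oneideal, of S] that finite_subset[OF that finite_atoms[OF assms]]
      atoms_carrier by blast
  moreover have "atoms_below x \<subseteq> atoms" for x by (auto simp: atoms_below_def)
  ultimately have "atoms_below ` carrier R = Pow atoms" by blast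
  then show ?thesis using inj_on_atoms_below[OF assms] by (simp add: bij_betw_def)
qed

text \<open>Forwards, \<open>a = a \<otimes> x\<close> is absorbed by \<open>J\<close>. Backwards,
  \<open>J\<close> contains an element with the same atoms as \<open>x\<close>, which is
  \<open>x\<close> by injectivity.\<close>

lemma mem_ideal_iff_atoms_below:
  assumes "finite (carrier R)" "ideal J R" "x \<in> carrier R"
  shows "x \<in> J \<longleftrightarrow> atoms_below x \<subseteq> J \<inter> atoms"
proof
  assume x: "x \<in> J"
  show "atoms_below x \<subseteq> J \<inter> atoms"
  proof
    fix a assume "a \<in> atoms_below x"
    then have "a \<in> atoms" "a \<otimes> x = a" by (simp_all add: atoms_below_def)
    then show "a \<in> J \<inter> atoms"
      using ideal.I_l_closed[OF assms(2) x, of a] atoms_carrier by simp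
  qed
next
  assume sub: "atoms_below x \<subseteq> J \<inter> atoms"
  moreover have "finite (atoms_below x)"
    using finite_subset[OF _ finite_atoms[OF assms(1)]] sub by blast
  ultimately obtain y where "y \<in> J" "atoms_below y = atoms_below x"
    using ex_atoms_below_eq[OF assms(2)] by blast
  then show "x \<in> J"
    using inj_on_atoms_below[OF assms(1)] assms(2,3) by (metis ideal.Icarr inj_onD)
qed

text \<open>These ideals provide the inverse of \<open>\<lambda>J. J \<inter> atoms\<close>.\<close>

lemma ideal_atoms_below_subset: "ideal {x \<in> carrier R. atoms_below x \<subseteq> S} R"
proof (rule idealI)
  show "subgroup {x \<in> carrier R. atoms_below x \<subseteq> S} (add_monoid R)"
  proof (rule add.subgroupI)
    show "{x \<in> carrier R. atoms_below x \<subseteq> S} \<noteq> {}"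
      using atoms_below_zero by auto
    show "\<ominus> x \<in> {x \<in> carrier R. atoms_below x \<subseteq> S}"
      if "x \<in> {x \<in> carrier R. atoms_below x \<subseteq> S}" for x
      using that minus_equality[OF add_self, of x] by simp
  qed (auto simp: atoms_below_add)
next
  fix x y assume "x \<in> {x \<in> carrier R. atoms_below x \<subseteq> S}" "y \<in> carrier R"
  then show "y \<otimes> x \<in> {x \<in> carrier R. atoms_below x \<subseteq> S}"
    using atoms_below_mult[of y x] by auto
  then show "x \<otimes> y \<in> {x \<in> carrier R. atoms_below x \<subseteq> S}"
    using m_comm[of x y] \<open>x \<in> _\<close> \<open>y \<in> _\<close> by simp
qed (rule ring_axioms)

lemma bij_betw_ideal_atoms:
  assumes "finite (carrier R)"
  shows "bij_betw (\<lambda>J. J \<inter> atoms) {J. ideal J R} (Pow atoms)"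
proof (rule bij_betw_byWitness[where f' = "\<lambda>S. {x \<in> carrier R. atoms_below x \<subseteq> S}"])
  show "\<forall>J\<in>{J. ideal J R}. {x \<in> carrier R. atoms_below x \<subseteq> J \<inter> atoms} = J"
  proof
    fix J assume "J \<in> {J. ideal J R}"
    then have J: "ideal J R" by simp
    show "{x \<in> carrier R. atoms_below x \<subseteq> J \<inter> atoms} = J"
      using mem_ideal_iff_atoms_below[OF assms J] ideal.Icarr[OF J] by blast
  qed
  show "\<forall>S\<in>Pow atoms. {x \<in> carrier R. atoms_below x \<subseteq> S} \<inter> atoms = S"
    by (auto simp: atoms_below_atom atoms_carrier)
qed (auto simp: ideal_atoms_below_subset)

section \<open>Counting tuples of ideals with zero product\<close>

lemma card_ideal_tuples_prod_zero:
  assumes "finite (carrier R)" "finite K" "K \<noteq> {}"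
  shows "card {I \<in> K \<rightarrow>\<^sub>E {J. ideal J R}. (\<Otimes>\<^bsub>ideals_set R\<^esub> i \<in> K. I i) = {\<zero>}}
    = (2 ^ card K - 1) ^ card atoms"
proof -
  let ?f = "\<lambda>J. J \<inter> atoms"
  have prod_zero: "(\<Otimes>\<^bsub>ideals_set R\<^esub> i \<in> K. I i) = {\<zero>} \<longleftrightarrow> (\<Inter>i\<in>K. ?f (I i)) = {}"
    if I: "I \<in> K \<rightarrow>\<^sub>E {J. ideal J R}" for I
  proof -
    have *: "(\<Otimes>\<^bsub>ideals_set R\<^esub> i \<in> K. I i) = (\<Inter>i\<in>K. I i)" "ideal (\<Inter>i\<in>K. I i) R"
      using finprod_ideals_set_eq_Inter[OF assms(2,3), of I] I by auto
    have "{\<zero>} \<inter> atoms = {}" by (auto dest: atoms_nonzero)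
    moreover have "(\<Inter>i\<in>K. ?f (I i)) = ?f (\<Inter>i\<in>K. I i)" using assms(3) by auto
    \<comment> \<open>An ideal is determined by its atoms, so the zero ideal is the only one without
      atoms.\<close>
    moreover have "(\<Inter>i\<in>K. I i) = {\<zero>} \<longleftrightarrow> ?f (\<Inter>i\<in>K. I i) = ?f {\<zero>}"
      by (rule inj_on_eq_iff[symmetric, OF bij_betw_imp_inj_on[OF bij_betw_ideal_atoms[OF assms(1)]]])
        (simp_all add: *(2) zeroideal)
    ultimately show ?thesis using *(1) by simp
  qed
  have "bij_betw (\<lambda>I. \<lambda>i\<in>K. ?f (I i))
     {I \<in> K \<rightarrow>\<^sub>E {J. ideal J R}. (\<Otimes>\<^bsub>ideals_set R\<^esub> i \<in> K. I i) = {\<zero>}}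
     {F \<in> K \<rightarrow>\<^sub>E Pow atoms. (\<Inter>i\<in>K. F i) = {}}"
    by (rule bij_betw_Collect[OF bij_betw_PiE_comp[OF bij_betw_ideal_atoms[OF assms(1)]]])
      (simp add: prod_zero)
  then show ?thesis
    by (simp only: bij_betw_same_card
        card_tuples_empty_Inter[OF finite_atoms[OF assms(1)] assms(2,3)])
qed

end

theorem proposition4p3:
  fixes R :: "('a, 'b) ring_scheme" and n k :: nat
  assumes "boolean_ring R"
    and "finite (carrier R)"
    and "card (carrier R) = 2 ^ n"
    and "n \<ge> 1"
    and "k \<ge> 2"
  shows "zeta k R = (1 - 1 / 2 ^ k) ^ n"
proof -
  interpret boolean_ring R by fact
  have card_Pow_atoms: "card (Pow atoms) = 2 ^ card atoms"
    using finite_atoms[OF assms(2)] by (rule card_Pow)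
  have n: "card atoms = n"
    using bij_betw_same_card[OF bij_betw_atoms_below[OF assms(2)]] card_Pow_atoms assms(3) by simp
  have "card {J. ideal J R} = 2 ^ n"
    using bij_betw_same_card[OF bij_betw_ideal_atoms[OF assms(2)]] card_Pow_atoms n by simp
  moreover have "card {I \<in> {1..k} \<rightarrow>\<^sub>E {J. ideal J R}.
      (\<Otimes>\<^bsub>ideals_set R\<^esub> i \<in> {1..k}. I i) = {\<zero>\<^bsub>R\<^esub>}} = (2 ^ k - 1) ^ n"
    using card_ideal_tuples_prod_zero[OF assms(2), of "{1..k}"] assms(5) n by simp
  \<comment> \<open>The truncated subtraction on \<open>nat\<close> agrees with the real one because
    \<open>2 ^ k\<close> is at least 1.\<close>
  ultimately have "zeta k R = (2 ^ k - 1) ^ n / (2 ^ n) ^ k"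
    by (simp add: zeta_def of_nat_diff)
  \<comment> \<open>Both \<open>(2 ^ n) ^ k\<close> and \<open>(2 ^ k) ^ n\<close> equal
    \<open>2 ^ (n * k)\<close>.\<close>
  also have "\<dots> = ((2 ^ k - 1) / 2 ^ k) ^ n"
    by (simp add: power_divide mult.commute flip: power_mult)
  also have "\<dots> = (1 - 1 / 2 ^ k) ^ n"
    by (simp add: diff_divide_distrib)
  finally show ?thesis .
qed

end
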